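(* Let $G$ be a finite simple planar graph with $\delta(G)\geq 2$ and $g(G)\geq 10$. Then $G$ contains at least one of the following configurations: (a) an edge both of whose endpoints have degree $2$; (b) a vertex $v$ with $d(v)\geq 3$ all of whose $d(v)$ neighbors have degree $2$.
   Context: $d(x)$ denotes the degree of vertex $x$, $\delta(G)$ the minimum degree, and $g(G)$ the girth (length of a shortest cycle). *)

theory Defs
  imports
    "HOL-Analysis.Analysis"
    "HOL-Library.Extended_Nat"
    "Graph_Theory.Graph_Theory"
begin

text \<open>
  A finite simple graph is a \<^locale>\<open>pair_graph\<close>: a finite, loop-free, symmetric set of ordered pairs.
  An undirected edge \<open>{u, v}\<close> is represented by the two arcs \<open>(u, v)\<close> and \<open>(v, u)\<close>; hence the arcs
  leaving a vertex correspond bijectively to its incident edges, and to its neighbours.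
\<close>

definition vdegree :: "'a pair_pre_digraph \<Rightarrow> 'a \<Rightarrow> nat" where
  "vdegree G v = out_degree (with_proj G) v"

text \<open>Meaningful for graphs with a finite nonempty vertex set only.\<close>

definition min_degree :: "'a pair_pre_digraph \<Rightarrow> nat" where
  "min_degree G = Min (vdegree G ` pverts G)"

text \<open>
  The closed walk \<open>u, v, u\<close> along a single undirected edge is a \<^const>\<open>pre_digraph.cycle\<close> of the
  symmetric digraph, but not a cycle of the undirected graph; the bound 3 excludes exactly these.
  The girth of an acyclic graph is \<open>\<infinity>\<close>.
\<close>

definition girth :: "'a pair_pre_digraph \<Rightarrow> enat" where
  "girth G = (INF p \<in> {p. pre_digraph.cycle (with_proj G) p \<and> 3 \<le> length p}. enat (length p))"

text \<open>
  The plane is \<^typ>\<open>complex\<close>. Both orientations of an edge are drawn as the same curve.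
\<close>

definition plane_drawing ::
  "'a pair_pre_digraph \<Rightarrow> ('a \<Rightarrow> complex) \<Rightarrow> ('a \<times> 'a \<Rightarrow> real \<Rightarrow> complex) \<Rightarrow> bool" where
  "plane_drawing G pos crv \<longleftrightarrow>
     inj_on pos (pverts G) \<and>
     (\<forall>u v. (u, v) \<in> parcs G \<longrightarrow>
        arc (crv (u, v)) \<and>
        pathstart (crv (u, v)) = pos u \<and>
        pathfinish (crv (u, v)) = pos v \<and>
        crv (v, u) = reversepath (crv (u, v)) \<and>
        path_image (crv (u, v)) \<inter> pos ` pverts G = {pos u, pos v}) \<and>
     (\<forall>u v x y. (u, v) \<in> parcs G \<longrightarrow> (x, y) \<in> parcs G \<longrightarrow> {u, v} \<noteq> {x, y} \<longrightarrow>
        path_image (crv (u, v)) \<inter> path_image (crv (x, y)) \<subseteq> pos ` ({u, v} \<inter> {x, y}))"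

definition planar :: "'a pair_pre_digraph \<Rightarrow> bool" where
  "planar G \<longleftrightarrow> (\<exists>pos crv. plane_drawing G pos crv)"

end

theory Submission
  imports Defs
begin

text \<open>
  Adding the edges of a drawing one at a time shows that a plane graph with n vertices and m edges
  has at least m - n + 2 faces: by the Jordan curve theorem, an edge that closes a cycle splits a
  face. By Janiszewski's theorem a drawn forest does not separate the plane, so unless the graph is
  a forest, the edges on the boundary of any face contain a cycle, hence number at least the girth;
  Janiszewski and Jordan together show that an edge is on the boundary of at most two faces. Double
  counting then gives 8 m < 10 n if the girth is at least 10, i.e. an average degree below 5/2. If
  both configurations are absent, discharging shows that the average degree is at least 5/2.
\<close>

hide_const (open) Digraph_Component.connected

section \<open>Edge sets\<close>

definition adj :: "'a set set \<Rightarrow> 'a rel" where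
  "adj H = {(u, v). {u, v} \<in> H}"

lemma sym_adj: "sym (adj H)"
  by (auto simp: adj_def sym_def insert_commute)

lemma adj_rtrancl_commute: "(u, v) \<in> (adj H)\<^sup>* \<longleftrightarrow> (v, u) \<in> (adj H)\<^sup>*"
  using sym_rtrancl[OF sym_adj, of H] by (auto dest: symD)

lemma adj_rtrancl_mono: "H \<subseteq> K \<Longrightarrow> (adj H)\<^sup>* \<subseteq> (adj K)\<^sup>*"
  by (rule rtrancl_mono) (auto simp: adj_def)

text \<open>A forest, in the form that every edge is a bridge. This suits both uses: building a
  drawing from bridges, and closing a simple path by an edge that is no bridge. A singleton in
  \<open>H\<close> counts as a cycle.\<close>

definition acyclic_edges :: "'a set set \<Rightarrow> bool" where
  "acyclic_edges H \<longleftrightarrow> (\<forall>a b. {a, b} \<in> H \<longrightarrow> (a, b) \<notin> (adj (H - {{a, b}}))\<^sup>*)"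

lemma acyclic_edges_subset: "acyclic_edges K \<Longrightarrow> H \<subseteq> K \<Longrightarrow> acyclic_edges H"
  unfolding acyclic_edges_def
  by (meson Diff_mono adj_rtrancl_mono order_refl subset_iff)

fun path_edges :: "'a list \<Rightarrow> 'a set set" where
  "path_edges (x # y # zs) = insert {x, y} (path_edges (y # zs))"
| "path_edges _ = {}"

lemma path_edges_subset: "e \<in> path_edges xs \<Longrightarrow> e \<subseteq> set xs"
  by (induction xs rule: path_edges.induct) auto

lemma finite_path_edges [simp]: "finite (path_edges xs)"
  by (induction xs rule: path_edges.induct) auto

lemma path_edges_suffix: "path_edges ys \<subseteq> path_edges (xs @ ys)"
proof (induction xs)
  case (Cons x xs)
  have "path_edges (xs @ ys) \<subseteq> path_edges (x # xs @ ys)"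
    by (cases "xs @ ys") auto
  with Cons show ?case by auto
qed simp

lemma card_path_edges: "distinct xs \<Longrightarrow> card (path_edges xs) = length xs - 1"
proof (induction xs rule: path_edges.induct)
  case (1 x y zs)
  have "{x, y} \<notin> path_edges (y # zs)"
    using path_edges_subset[of "{x, y}" "y # zs"] 1(2) by auto
  with 1 show ?case by simp
qed auto

text \<open>Loop erasure: the path grows at its front, and when the new first vertex already lies on
  it, everything before that occurrence is dropped.\<close>

lemma rtrancl_adj_simple_path:
  assumes "(a, b) \<in> (adj H)\<^sup>*"
  shows "\<exists>xs. xs \<noteq> [] \<and> hd xs = a \<and> last xs = b \<and> distinct xs \<and> path_edges xs \<subseteq> H"
  using assms
proof (induction rule: converse_rtrancl_induct)
  case base
  show ?case by (rule exI[of _ "[b]"]) simp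
next
  case (step x y)
  from step.IH obtain ys where
    ys: "ys \<noteq> []" "hd ys = y" "last ys = b" "distinct ys" "path_edges ys \<subseteq> H"
    by blast
  show ?case
  proof (cases "x \<in> set ys")
    case True
    then obtain as bs where "ys = as @ x # bs"
      by (meson split_list)
    then have "last (x # bs) = b" "distinct (x # bs)" "path_edges (x # bs) \<subseteq> H"
      using ys(3-5) path_edges_suffix[of "x # bs" as] by simp_all
    then show ?thesis
      by (intro exI[of _ "x # bs"]) simp
  next
    case False
    obtain zs where zs: "ys = y # zs"
      using ys(1,2) by (cases ys) auto
    then have "path_edges (x # ys) \<subseteq> H"
      using ys(5) step.hyps(1) by (simp add: adj_def)
    then show ?thesis
      using ys(1,3,4) False by (intro exI[of _ "x # ys"]) simp
  qed
qed

section \<open>Connected components and the insertion of one edge\<close>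

definition num_comps :: "'a set \<Rightarrow> 'a set set \<Rightarrow> nat" where
  "num_comps V H = card ((\<lambda>v. {w \<in> V. (v, w) \<in> (adj H)\<^sup>*}) ` V)"

lemma num_comps_empty: "num_comps (V :: 'a set) {} = card V"
proof -
  have "adj ({} :: 'a set set) = {}" by (auto simp: adj_def)
  then have "(\<lambda>v. {w \<in> V. (v, w) \<in> (adj {})\<^sup>*}) ` V = (\<lambda>v. {v}) ` V"
    by (intro image_cong) auto
  then show ?thesis
    by (simp add: num_comps_def card_image)
qed

lemma num_comps_pos: "finite V \<Longrightarrow> V \<noteq> {} \<Longrightarrow> num_comps V H \<ge> 1"
  by (simp add: num_comps_def Suc_le_eq card_gt_0_iff)

text \<open>A walk that uses the new edge can be cut at its first and its last visit to an end of
  that edge; the two outer pieces stay in \<open>H\<close>.\<close>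

lemma adj_rtrancl_insert:
  "(u, v) \<in> (adj (insert {a, b} H))\<^sup>* \<longleftrightarrow>
     (u, v) \<in> (adj H)\<^sup>* \<or>
     ((u, a) \<in> (adj H)\<^sup>* \<or> (u, b) \<in> (adj H)\<^sup>*) \<and> ((a, v) \<in> (adj H)\<^sup>* \<or> (b, v) \<in> (adj H)\<^sup>*)"
  (is "?L \<longleftrightarrow> ?R")
proof
  assume ?L
  then show ?R
  proof (induction rule: rtrancl_induct)
    case (step y z)
    then have "(y, z) \<in> adj H \<or> (y = a \<and> z = b) \<or> (y = b \<and> z = a)"
      by (auto simp: adj_def doubleton_eq_iff)
    with step.IH show ?case
      by (auto intro: rtrancl_into_rtrancl)
  qed simp
next
  have ab: "(a, b) \<in> (adj (insert {a, b} H))\<^sup>*" "(b, a) \<in> (adj (insert {a, b} H))\<^sup>*"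
    by (auto simp: adj_def insert_commute)
  have mono: "(adj H)\<^sup>* \<subseteq> (adj (insert {a, b} H))\<^sup>*"
    by (rule adj_rtrancl_mono) auto
  have "(u, a) \<in> (adj (insert {a, b} H))\<^sup>*" if "(u, a) \<in> (adj H)\<^sup>* \<or> (u, b) \<in> (adj H)\<^sup>*"
    using that mono ab(2) rtrancl_trans[of u b _ a] by blast
  moreover have "(a, v) \<in> (adj (insert {a, b} H))\<^sup>*"
    if "(a, v) \<in> (adj H)\<^sup>* \<or> (b, v) \<in> (adj H)\<^sup>*"
    using that mono ab(1) rtrancl_trans[of a b _ v] by blast
  moreover assume ?R
  ultimately show ?L
    using mono rtrancl_trans[of u a _ v] by blast
qed

lemma num_comps_insert_cycle:
  assumes "(a, b) \<in> (adj H)\<^sup>*"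
  shows "num_comps V (insert {a, b} H) = num_comps V H"
proof -
  have "(u, v) \<in> (adj (insert {a, b} H))\<^sup>* \<longleftrightarrow> (u, v) \<in> (adj H)\<^sup>*" for u v
  proof -
    have "(b, a) \<in> (adj H)\<^sup>*"
      using assms by (simp add: adj_rtrancl_commute[of b a])
    then have "(u, a) \<in> (adj H)\<^sup>* \<longleftrightarrow> (u, b) \<in> (adj H)\<^sup>*" "(a, v) \<in> (adj H)\<^sup>* \<longleftrightarrow> (b, v) \<in> (adj H)\<^sup>*"
      using assms rtrancl_trans[of u a "adj H" b] rtrancl_trans[of u b "adj H" a]
        rtrancl_trans[of a b "adj H" v] rtrancl_trans[of b a "adj H" v] by blast+
    then show ?thesis
      using rtrancl_trans[of u a "adj H" v] unfolding adj_rtrancl_insert by blast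
  qed
  then show ?thesis
    by (simp add: num_comps_def)
qed

text \<open>The classes of \<open>a\<close> and \<open>b\<close> merge into their union and all
  other classes survive unchanged.\<close>

lemma num_comps_insert_bridge:
  assumes "finite V" "a \<in> V" "b \<in> V" "(a, b) \<notin> (adj H)\<^sup>*"
  shows "num_comps V (insert {a, b} H) + 1 \<le> num_comps V H"
proof -
  define C where "C v = {w \<in> V. (v, w) \<in> (adj H)\<^sup>*}" for v
  define C' where "C' v = {w \<in> V. (v, w) \<in> (adj (insert {a, b} H))\<^sup>*}" for v
  have in_C: "a \<in> C a" "b \<in> C b" "b \<notin> C a"
    using assms by (simp_all add: C_def)
  then have ne: "C a \<noteq> C b" by blast
  have "C' v \<in> insert (C a \<union> C b) (C ` V - {C a, C b})" if "v \<in> V" for v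
  proof (cases "(v, a) \<in> (adj H)\<^sup>* \<or> (v, b) \<in> (adj H)\<^sup>*")
    case True
    have "C' v = C a \<union> C b"
    proof -
      have "(a, v) \<in> (adj H)\<^sup>* \<or> (b, v) \<in> (adj H)\<^sup>*"
        using True by (simp add: adj_rtrancl_commute[of _ v])
      then have "(v, w) \<in> (adj (insert {a, b} H))\<^sup>* \<longleftrightarrow>
          (a, w) \<in> (adj H)\<^sup>* \<or> (b, w) \<in> (adj H)\<^sup>*" for w
        using True rtrancl_trans[of a v "adj H" w] rtrancl_trans[of b v "adj H" w]
        unfolding adj_rtrancl_insert by blast
      then show ?thesis by (auto simp: C_def C'_def)
    qed
    then show ?thesis by simp
  next
    case False
    then have "C' v = C v"
      unfolding C_def C'_def adj_rtrancl_insert by simp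
    moreover have "a \<notin> C v" "b \<notin> C v"
      using False by (simp_all add: C_def)
    then have "C v \<noteq> C a" "C v \<noteq> C b"
      using in_C by blast+
    ultimately show ?thesis using that by auto
  qed
  then have "C' ` V \<subseteq> insert (C a \<union> C b) (C ` V - {C a, C b})" by auto
  then have "card (C' ` V) \<le> card (insert (C a \<union> C b) (C ` V - {C a, C b}))"
    using assms(1) by (intro card_mono) auto
  also have "\<dots> \<le> Suc (card (C ` V - {C a, C b}))"
    by (rule card_insert_le_m1) auto
  also have "card (C ` V - {C a, C b}) = card (C ` V) - 2"
    using ne assms by (subst card_Diff_subset) auto
  finally have "card (C' ` V) \<le> Suc (card (C ` V) - 2)" .
  \<comment> \<open>There are at least two old classes, so the truncated subtraction of 2 is
    exact.\<close>
  moreover have "card {C a, C b} \<le> card (C ` V)"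
    using assms by (intro card_mono) auto
  ultimately have "card (C' ` V) + 1 \<le> card (C ` V)"
    using ne by simp
  then show ?thesis
    unfolding num_comps_def C_def C'_def .
qed

section \<open>Drawings\<close>

text \<open>An arc is homeomorphic to an interval, so an interior point would yield an embedding of
  a nonempty open subset of the plane into the line, against invariance of dimension.\<close>

lemma interior_arc_image:
  fixes g :: "real \<Rightarrow> complex"
  assumes "arc g"
  shows "interior (path_image g) = {}"
proof (rule ccontr)
  assume ne: "interior (path_image g) \<noteq> {}"
  obtain h where h: "homeomorphism {0..1} (path_image g) g h"
    using assms unfolding arc_def path_image_def path_def
    by (meson compact_Icc homeomorphism_compact)
  have sub: "interior (path_image g) \<subseteq> path_image g"
    by (rule interior_subset)
  have "continuous_on (interior (path_image g)) h"
    using h sub by (meson continuous_on_subset homeomorphism_def)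
  moreover have "inj_on h (interior (path_image g))"
    using homeomorphism_apply2[OF h] sub by (intro inj_on_inverseI[of _ g]) blast
  ultimately have "DIM(complex) \<le> DIM(real)"
    using ne by (intro invariance_of_dimension[OF _ open_interior])
  then show False by simp
qed

text \<open>\<open>D e\<close> is a point set rather than a curve, so that an undirected edge
  carries no orientation; a parametrization is only asserted to exist.\<close>

locale drawn_graph =
  fixes V :: "'a set" and E :: "'a set set" and pos :: "'a \<Rightarrow> complex"
    and D :: "'a set \<Rightarrow> complex set"
  assumes finite_V: "finite V" and finite_E: "finite E" and inj_pos: "inj_on pos V"
    and edge: "e \<in> E \<Longrightarrow> \<exists>u v g. e = {u, v} \<and> u \<noteq> v \<and> u \<in> V \<and> v \<in> V \<and> arc g \<and>
      path_image g = D e \<and> pathstart g = pos u \<and> pathfinish g = pos v"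
    and edge_Int_verts: "e \<in> E \<Longrightarrow> D e \<inter> pos ` V \<subseteq> pos ` e"
    and edge_Int_edge: "e \<in> E \<Longrightarrow> e' \<in> E \<Longrightarrow> e \<noteq> e' \<Longrightarrow> D e \<inter> D e' \<subseteq> pos ` (e \<inter> e')"
begin

text \<open>All vertices are drawn whatever \<open>H\<close> is, so inserting an edge of
  \<open>E\<close> adds just its curve, and the empty edge set gives a finite set of points.\<close>

definition drawing :: "'a set set \<Rightarrow> complex set" where
  "drawing H = pos ` V \<union> \<Union>(D ` H)"

lemma drawing_insert: "drawing (insert e H) = drawing H \<union> D e"
  by (auto simp: drawing_def)

lemma drawing_mono: "H \<subseteq> K \<Longrightarrow> drawing H \<subseteq> drawing K"
  by (auto simp: drawing_def)

lemma edge_arc: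
  assumes "{u, v} \<in> E"
  obtains g where "arc g" "path_image g = D {u, v}" "pathstart g = pos u" "pathfinish g = pos v"
proof -
  obtain x y g where g: "{u, v} = {x, y}" "arc g" "path_image g = D {u, v}"
      "pathstart g = pos x" "pathfinish g = pos y"
    using edge[OF assms] by metis
  show ?thesis
  proof (cases "u = x \<and> v = y")
    case True
    with g that show ?thesis by blast
  next
    case False
    then have "u = y" "v = x" using g(1) by (auto simp: doubleton_eq_iff)
    with g that[of "reversepath g"] show ?thesis by (simp add: arc_reversepath)
  qed
qed

lemma edge_verts: "{u, v} \<in> E \<Longrightarrow> u \<in> V \<and> v \<in> V \<and> u \<noteq> v"
  using edge[of "{u, v}"] by (auto simp: doubleton_eq_iff)

lemma edge_subset: "e \<in> E \<Longrightarrow> e \<subseteq> V"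
  using edge[of e] by auto

lemma edge_endpoints: "e \<in> E \<Longrightarrow> pos ` e \<subseteq> D e"
  using edge[of e] by (metis empty_subsetI image_empty image_insert insert_subset
      pathfinish_in_path_image pathstart_in_path_image)

lemma compact_edge: "e \<in> E \<Longrightarrow> compact (D e)"
  using edge[of e] compact_arc_image by metis

lemma connected_edge: "e \<in> E \<Longrightarrow> connected (D e)"
  using edge[of e] connected_arc_image by metis

lemma connected_compl_edge: "e \<in> E \<Longrightarrow> connected (- D e)"
  using edge[of e] connected_arc_complement[where 'a = complex] by (metis DIM_complex order_refl)

lemma interior_edge: "e \<in> E \<Longrightarrow> interior (D e) = {}"
  using edge[of e] interior_arc_image by metis

lemma open_edge:
  assumes "e \<in> E"
  shows "connected (D e - pos ` e)" "D e - pos ` e \<noteq> {}"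
proof -
  obtain u v g where g: "e = {u, v}" "arc g" "path_image g = D e"
      "pathstart g = pos u" "pathfinish g = pos v"
    using edge[OF assms] by metis
  then have "D e - pos ` e = path_image g - {pathstart g, pathfinish g}" by auto
  then show "connected (D e - pos ` e)" "D e - pos ` e \<noteq> {}"
    using connected_simple_path_endless nonempty_simple_path_endless arc_imp_simple_path g(2)
    by metis+
qed

lemma compact_Union_edges: "H \<subseteq> E \<Longrightarrow> compact (\<Union>(D ` H))"
  using finite_subset[OF _ finite_E] compact_edge by (intro compact_UN) auto

lemma compact_drawing: "H \<subseteq> E \<Longrightarrow> compact (drawing H)"
  unfolding drawing_def
  by (intro compact_Un compact_Union_edges finite_imp_compact finite_imageI finite_V)

lemma open_compl_drawing: "H \<subseteq> E \<Longrightarrow> open (- drawing H)"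
  using compact_drawing compact_imp_closed by blast

lemma edge_Int_drawing:
  assumes "H \<subseteq> E" "e \<in> E" "e \<notin> H"
  shows "D e \<inter> drawing H \<subseteq> pos ` e"
proof -
  have "D e \<inter> D e' \<subseteq> pos ` e" if "e' \<in> H" for e'
    using edge_Int_edge[of e e'] assms that by blast
  with edge_Int_verts[OF assms(2)] show ?thesis
    unfolding drawing_def by blast
qed

lemma simple_path_arc:
  assumes "distinct xs" "path_edges xs \<subseteq> E" "length xs \<ge> 2"
  shows "\<exists>g. arc g \<and> path_image g = \<Union>(D ` path_edges xs) \<and>
    pathstart g = pos (hd xs) \<and> pathfinish g = pos (last xs)"
  using assms
proof (induction xs rule: path_edges.induct)
  case (1 x y zs)
  have xy: "{x, y} \<in> E" using 1 by simp
  obtain g where g: "arc g" "path_image g = D {x, y}" "pathstart g = pos x" "pathfinish g = pos y"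
    using edge_arc[OF xy] .
  show ?case
  proof (cases "zs = []")
    case True
    with g show ?thesis by auto
  next
    case False
    then have "length (y # zs) \<ge> 2" by (cases zs) auto
    with 1 obtain h where h: "arc h" "path_image h = \<Union>(D ` path_edges (y # zs))"
        "pathstart h = pos y" "pathfinish h = pos (last (y # zs))"
      by auto
    \<comment> \<open>By distinctness \<open>x\<close> lies on no later edge, so the first arc meets
      the rest only at \<open>pos y\<close>, as joining arcs requires.\<close>
    have "D {x, y} \<inter> D e \<subseteq> {pos y}" if "e \<in> path_edges (y # zs)" for e
    proof -
      have "x \<notin> e" using path_edges_subset[OF that] 1(2) by auto
      moreover from this have "D {x, y} \<inter> D e \<subseteq> pos ` ({x, y} \<inter> e)"
        using that 1(3) by (intro edge_Int_edge) auto
      ultimately show ?thesis by auto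
    qed
    then have "path_image g \<inter> path_image h \<subseteq> {pathstart h}"
      using g h by auto
    then have "arc (g +++ h)" using g h by (intro arc_join) auto
    then show ?thesis using g h by (intro exI[of _ "g +++ h"]) (auto simp: path_image_join)
  qed
qed auto

section \<open>Separation of points by an added edge\<close>

text \<open>Janiszewski's theorem is used three times: two compact sets with connected intersection,
  neither of which separates \<open>p\<close> from \<open>q\<close>, do not separate them together.
  The drawing of \<open>H\<close> splits into the part \<open>K W\<close> reachable from
  \<open>a\<close> and the rest; the new arc is joined to each part, then the two unions are
  joined.\<close>

lemma bridge_not_separating:
  assumes H: "H \<subseteq> E" and ab: "{a, b} \<in> E" "(a, b) \<notin> (adj H)\<^sup>*"
    and pq: "connected_component (- drawing H) p q" "p \<notin> D {a, b}" "q \<notin> D {a, b}"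
  shows "connected_component (- drawing (insert {a, b} H)) p q"
proof -
  define W where "W = {w \<in> V. (a, w) \<in> (adj H)\<^sup>*}"
  have aW: "a \<in> W" and bW: "b \<in> V - W"
    using edge_verts[OF ab(1)] ab(2) by (auto simp: W_def)
  have WV: "W \<subseteq> V" by (auto simp: W_def)
  have notin: "{a, b} \<notin> H" using ab(2) by (auto simp: adj_def)
  \<comment> \<open>Reachability from \<open>a\<close> is constant along an edge of
    \<open>H\<close>, so no edge crosses between \<open>W\<close> and its complement.\<close>
  have disj: "e \<subseteq> W \<or> e \<subseteq> V - W" if eH: "e \<in> H" for e
  proof -
    obtain u v where uv: "e = {u, v}" "u \<in> V" "v \<in> V" using edge[of e] eH H by blast
    then have "(u, v) \<in> adj H" "(v, u) \<in> adj H" using eH by (auto simp: adj_def insert_commute)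
    then have "u \<in> W \<longleftrightarrow> v \<in> W" using uv by (auto simp: W_def intro: rtrancl_into_rtrancl)
    then show ?thesis using uv by auto
  qed
  define K where "K U = pos ` U \<union> \<Union>(D ` {e \<in> H. e \<subseteq> U})" for U
  have KK: "drawing H = K W \<union> K (V - W)"
  proof -
    have "pos ` V = pos ` W \<union> pos ` (V - W)" using WV by auto
    moreover have "H = {e \<in> H. e \<subseteq> W} \<union> {e \<in> H. e \<subseteq> V - W}" using disj by blast
    then have "\<Union>(D ` H) = \<Union>(D ` {e \<in> H. e \<subseteq> W}) \<union> \<Union>(D ` {e \<in> H. e \<subseteq> V - W})"
      by (metis UN_Un)
    ultimately show ?thesis unfolding drawing_def K_def by auto
  qed
  have pos_in: "pos ` A \<inter> pos ` B = pos ` (A \<inter> B)" if "A \<subseteq> V" "B \<subseteq> V" for A B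
    using inj_on_image_Int[OF inj_pos that] by simp
  have DK: "D e \<inter> K U \<subseteq> pos ` (e \<inter> U)" if eU: "e \<in> E" "U \<subseteq> V" "\<not> (e \<in> H \<and> e \<subseteq> U)" for e U
  proof -
    have "D e \<inter> pos ` U \<subseteq> pos ` (e \<inter> U)"
      using edge_Int_verts[OF eU(1)] pos_in[OF edge_subset[OF eU(1)] eU(2)] eU(2) by blast
    moreover have "D e \<inter> D e' \<subseteq> pos ` (e \<inter> U)" if e': "e' \<in> H" "e' \<subseteq> U" for e'
    proof -
      have "e \<noteq> e'" using e' eU(3) by auto
      then show ?thesis using edge_Int_edge[of e e'] \<open>e \<in> E\<close> e' H by blast
    qed
    ultimately show ?thesis unfolding K_def by blast
  qed
  have disjK: "K W \<inter> K (V - W) = {}"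
  proof -
    have 1: "D e \<inter> K (V - W) = {}" if "e \<in> H" "e \<subseteq> W" for e
    proof -
      have "e \<noteq> {}" using edge[of e] that H by auto
      then have "D e \<inter> K (V - W) \<subseteq> pos ` (e \<inter> (V - W))"
        using that H by (intro DK) auto
      then show ?thesis using that by auto
    qed
    have 2: "pos ` W \<inter> pos ` (V - W) = {}" using pos_in[of W "V - W"] WV by auto
    have 3: "pos ` W \<inter> D e = {}" if "e \<in> H" "e \<subseteq> V - W" for e
    proof -
      have "pos ` W \<inter> pos ` e = {}" using pos_in[of W e] that WV by auto
      then show ?thesis using edge_Int_verts[of e] WV that(1) H by blast
    qed
    have "pos ` W \<inter> K (V - W) = {}"
      using 2 3 unfolding K_def by fast
    moreover have "\<Union>(D ` {e \<in> H. e \<subseteq> W}) \<inter> K (V - W) = {}"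
      using 1 by auto
    ultimately show ?thesis by (simp add: K_def[of W] Int_Un_distrib2)
  qed
  have aK: "K W \<inter> D {a, b} = {pos a}"
    using DK[OF ab(1) WV] notin aW bW edge_endpoints[OF ab(1)] by (auto simp: K_def)
  have bK: "K (V - W) \<inter> D {a, b} = {pos b}"
    using DK[OF ab(1), of "V - W"] notin aW bW edge_endpoints[OF ab(1)] by (auto simp: K_def)
  have cK: "compact (K U)" if "U \<subseteq> V" for U
    unfolding K_def using finite_subset[OF that finite_V] H
    by (intro compact_Un compact_Union_edges finite_imp_compact finite_imageI) auto
  have cD: "compact (D {a, b})" by (rule compact_edge[OF ab(1)])
  have D_pq: "connected_component (- D {a, b}) p q"
    using connected_compl_edge[OF ab(1)] pq by (simp add: connected_iff_connected_component)
  \<comment> \<open>A part that meets the arc in a single point has connected intersection with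
    it.\<close>
  have side: "connected_component (- (K U \<union> D {a, b})) p q"
    if "U \<subseteq> V" "K U \<subseteq> drawing H" "K U \<inter> D {a, b} = {z}" for U z
    using that cK cD D_pq connected_component_of_subset[OF pq(1), of "- K U"]
    by (intro Janiszewski) (auto simp: compact_imp_closed)
  \<comment> \<open>The parts being disjoint, the two enlarged sets meet exactly in the arc, which
    is connected.\<close>
  have "(K W \<union> D {a, b}) \<inter> (K (V - W) \<union> D {a, b}) = D {a, b}"
    using disjK by auto
  then have "connected_component (- ((K W \<union> D {a, b}) \<union> (K (V - W) \<union> D {a, b}))) p q"
    using side[OF _ _ aK] side[OF _ _ bK] WV KK cK cD connected_edge[OF ab(1)]
    by (intro Janiszewski[of "K W \<union> D {a, b}"] compact_Un closed_Un)
      (auto simp: compact_imp_closed)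
  moreover have "(K W \<union> D {a, b}) \<union> (K (V - W) \<union> D {a, b}) = drawing (insert {a, b} H)"
    using KK by (auto simp: drawing_insert)
  ultimately show ?thesis by simp
qed

text \<open>The Jordan curve is the new edge closed up by a simple path of \<open>H\<close>. It
  meets the old drawing in the arc of that path alone, which gives the connected intersection that
  Janiszewski's theorem asks for.\<close>

lemma cycle_curve:
  assumes H: "H \<subseteq> E" and ab: "{a, b} \<in> E" "{a, b} \<notin> H" "(a, b) \<in> (adj H)\<^sup>*"
  obtains c where "simple_path c" "pathfinish c = pathstart c" "D {a, b} \<subseteq> path_image c"
    "path_image c \<subseteq> drawing (insert {a, b} H)" "connected (drawing H \<inter> path_image c)"
proof -
  obtain xs where xs: "xs \<noteq> []" "hd xs = a" "last xs = b" "distinct xs" "path_edges xs \<subseteq> H"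
    using rtrancl_adj_simple_path[OF ab(3)] by blast
  have "a \<noteq> b" using edge_verts[OF ab(1)] by simp
  then have "length xs \<ge> 2" using xs by (cases xs rule: path_edges.cases) auto
  then obtain h where h: "arc h" "path_image h = \<Union>(D ` path_edges xs)"
      "pathstart h = pos a" "pathfinish h = pos b"
    using simple_path_arc[of xs] xs H by auto
  obtain g where g: "arc g" "path_image g = D {a, b}" "pathstart g = pos b" "pathfinish g = pos a"
    using edge_arc[of b a] ab(1) by (metis insert_commute)
  have hH: "path_image h \<subseteq> drawing H"
    using h xs(5) by (auto simp: drawing_def)
  have gH: "D {a, b} \<inter> drawing H \<subseteq> {pos a, pos b}"
    using edge_Int_drawing[OF H ab(1,2)] by simp
  have ends: "{pos a, pos b} \<subseteq> path_image h"
    using h pathfinish_in_path_image pathstart_in_path_image by (metis empty_subsetI insert_subset)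
  have sp: "simple_path (g +++ h)"
    using g h hH gH by (intro simple_path_join_loop) auto
  have im: "path_image (g +++ h) = D {a, b} \<union> path_image h"
    using g h by (simp add: path_image_join)
  have "drawing H \<inter> path_image (g +++ h) = path_image h"
    using im hH gH ends by auto
  then show ?thesis
    using that[OF sp] g h hH im connected_arc_image[OF h(1)] by (auto simp: drawing_insert)
qed

text \<open>Two points on the same side of \<open>c\<close> are connected off \<open>c\<close> by
  the Jordan curve theorem, and off the old drawing by assumption; Janiszewski's theorem combines
  the two.\<close>

lemma cycle_two_sides:
  assumes H: "H \<subseteq> E" and c: "simple_path c" "pathfinish c = pathstart c" "D e \<subseteq> path_image c"
      "path_image c \<subseteq> drawing (insert e H)" "connected (drawing H \<inter> path_image c)"
    and pq: "connected_component (- drawing H) p q" "p \<notin> path_image c" "q \<notin> path_image c"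
    and side: "p \<in> inside (path_image c) \<longleftrightarrow> q \<in> inside (path_image c)"
  shows "connected_component (- drawing (insert e H)) p q"
proof -
  have "connected_component (- path_image c) p q"
  proof -
    note J = Jordan_inside_outside[OF c(1,2)]
    have "(p \<in> inside (path_image c) \<and> q \<in> inside (path_image c)) \<or>
        (p \<in> outside (path_image c) \<and> q \<in> outside (path_image c))"
      using side J pq by blast
    moreover have "inside (path_image c) \<subseteq> - path_image c" "outside (path_image c) \<subseteq> - path_image c"
      using J by blast+
    ultimately show ?thesis
      using J unfolding connected_component_def by blast
  qed
  then have "connected_component (- (drawing H \<union> path_image c)) p q"
    using compact_drawing[OF H] pq(1) c(5) closed_simple_path_image[OF c(1)]
    by (intro Janiszewski) auto
  moreover have "drawing H \<union> path_image c = drawing (insert e H)"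
    using c(3,4) by (auto simp: drawing_insert)
  ultimately show ?thesis by simp
qed

section \<open>Edges on the boundary of faces\<close>

text \<open>For a face \<open>F\<close>, this says that \<open>e\<close> is on its boundary. The
  ends of \<open>e\<close> are left out because a face may reach a vertex without running along
  every edge there.\<close>

definition touches :: "'a set \<Rightarrow> complex set \<Rightarrow> bool" where
  "touches e F \<longleftrightarrow> closure F \<inter> (D e - pos ` e) \<noteq> {}"

text \<open>Without \<open>e\<close>, all faces touching \<open>e\<close> lie in one face of
  \<open>H\<close>, since the open edge is connected and avoids the drawing of \<open>H\<close>.
  Restoring \<open>e\<close> cuts it into pieces that are told apart by one Boolean.\<close>

lemma edge_two_faces:
  assumes H: "H \<subseteq> E" and e: "e \<in> E" "e \<notin> H"
    and FS: "FS \<subseteq> components (- drawing (insert e H))" "\<And>F. F \<in> FS \<Longrightarrow> touches e F"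
  shows "card FS \<le> 2"
proof -
  obtain a b where ab: "e = {a, b}" using edge[OF e(1)] by blast
  \<comment> \<open>If \<open>e\<close> closes a cycle, \<open>side\<close> tells whether a point is
    inside the Jordan curve; for a bridge it is constant.\<close>
  obtain side :: "complex \<Rightarrow> bool" where side:
    "\<And>p q. connected_component (- drawing H) p q \<Longrightarrow> p \<notin> drawing (insert e H) \<Longrightarrow>
      q \<notin> drawing (insert e H) \<Longrightarrow> side p = side q \<Longrightarrow>
      connected_component (- drawing (insert e H)) p q"
  proof (cases "(a, b) \<in> (adj H)\<^sup>*")
    case True
    then obtain c where "simple_path c" "pathfinish c = pathstart c" "D e \<subseteq> path_image c"
        "path_image c \<subseteq> drawing (insert e H)" "connected (drawing H \<inter> path_image c)"
      using cycle_curve[OF H] e ab by metis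
    then show ?thesis
      using that[of "\<lambda>p. p \<in> inside (path_image c)"] cycle_two_sides[OF H] by blast
  next
    case False
    then show ?thesis
      using that[of "\<lambda>_. True"] bridge_not_separating[OF H] e ab by (auto simp: drawing_insert)
  qed
  define pt where "pt F = (SOME p. p \<in> F)" for F :: "complex set"
  have pt: "pt F \<in> F" if "F \<in> FS" for F
  proof -
    have "F \<noteq> {}" using that FS(1) in_components_nonempty by blast
    then show ?thesis unfolding pt_def by (simp add: some_in_eq)
  qed
  have sub: "F \<subseteq> - drawing (insert e H)" if "F \<in> FS" for F
    using that FS(1) in_components_subset by blast
  have open_e: "D e - pos ` e \<subseteq> - drawing H"
    using edge_Int_drawing[OF H e] by blast
  \<comment> \<open>Adding to \<open>F\<close> a point of its closure keeps it connected, which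
    links \<open>F\<close> to the open edge off the drawing of \<open>H\<close>.\<close>
  have reach: "\<exists>z \<in> D e - pos ` e. connected_component (- drawing H) (pt F) z" if F: "F \<in> FS" for F
  proof -
    obtain z where z: "z \<in> closure F" "z \<in> D e - pos ` e"
      using FS(2)[OF F] by (auto simp: touches_def)
    have "connected F" using F FS(1) in_components_connected by blast
    then have "connected (insert z F)"
      by (rule connected_intermediate_closure) (use z closure_subset in auto)
    moreover have "insert z F \<subseteq> - drawing H"
      using z(2) open_e sub[OF F] by (auto simp: drawing_insert)
    ultimately show ?thesis
      using z(2) pt[OF F] unfolding connected_component_def by blast
  qed
  have "inj_on (side \<circ> pt) FS"
  proof (rule inj_onI)
    fix F F' assume F: "F \<in> FS" "F' \<in> FS" and eq: "(side \<circ> pt) F = (side \<circ> pt) F'"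
    obtain z z' where z: "z \<in> D e - pos ` e" "connected_component (- drawing H) (pt F) z"
        "z' \<in> D e - pos ` e" "connected_component (- drawing H) (pt F') z'"
      using reach F by meson
    have "connected_component (- drawing H) z z'"
      using open_edge(1)[OF e(1)] open_e z unfolding connected_component_def by blast
    then have "connected_component (- drawing H) (pt F) (pt F')"
      using z by (meson connected_component_sym connected_component_trans)
    then have "connected_component (- drawing (insert e H)) (pt F) (pt F')"
      using side eq pt sub F by (metis ComplD comp_apply subsetD)
    then obtain T where "connected T" "T \<subseteq> - drawing (insert e H)" "pt F \<in> T" "pt F' \<in> T"
      unfolding connected_component_def by blast
    then have "T \<subseteq> F" "T \<subseteq> F'"
      using components_maximal pt F FS(1) by blast+
    then show "F = F'"
      using components_nonoverlap \<open>pt F \<in> T\<close> F FS(1) by blast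
  qed
  then have "card FS \<le> card (UNIV :: bool set)"
    by (intro card_inj_on_le) auto
  then show ?thesis by simp
qed

section \<open>Counting faces as edges are added\<close>

text \<open>A nonempty open face cannot be covered by an arc, whose interior is empty; the component
  of any remaining point serves.\<close>

lemma face_below:
  assumes H: "H \<subseteq> E" and e: "e \<in> E" and F: "F \<in> components (- drawing H)"
  shows "\<exists>F'. F' \<in> components (- drawing (insert e H)) \<and> F' \<subseteq> F"
proof -
  have "open F" using open_components[OF open_compl_drawing[OF H] F] .
  moreover have "F \<noteq> {}" using F in_components_nonempty by blast
  ultimately have "\<not> F \<subseteq> D e" using interior_edge[OF e] interior_maximal by blast
  then obtain p where p: "p \<in> F" "p \<notin> D e" by blast
  moreover have "F \<subseteq> - drawing H" using F in_components_subset by blast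
  ultimately have pd: "p \<in> - drawing (insert e H)" by (auto simp: drawing_insert)
  let ?F = "connected_component_set (- drawing (insert e H)) p"
  have "?F \<subseteq> - drawing H"
    using connected_component_subset drawing_insert by blast
  moreover have "F \<inter> ?F \<noteq> {}"
    using p pd by auto
  ultimately have "?F \<subseteq> F"
    by (intro components_maximal[OF F connected_connected_component])
  then show ?thesis using componentsI[OF pd] by blast
qed

text \<open>A point \<open>z\<close> of the open edge lies in a face \<open>U\<close> of
  \<open>H\<close> and on the Jordan curve, hence in the frontier of both sides of the curve. So the
  open set \<open>U\<close> has points on both sides, and these end up in different faces.\<close>

lemma cycle_splits_face:
  assumes H: "H \<subseteq> E" and ab: "{a, b} \<in> E" "{a, b} \<notin> H" "(a, b) \<in> (adj H)\<^sup>*"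
  shows "\<exists>U F1 F2. U \<in> components (- drawing H) \<and> F1 \<noteq> F2 \<and> F1 \<subseteq> U \<and> F2 \<subseteq> U \<and>
    F1 \<in> components (- drawing (insert {a, b} H)) \<and> F2 \<in> components (- drawing (insert {a, b} H))"
proof -
  obtain c where c: "simple_path c" "pathfinish c = pathstart c" "D {a, b} \<subseteq> path_image c"
      "path_image c \<subseteq> drawing (insert {a, b} H)" "connected (drawing H \<inter> path_image c)"
    using cycle_curve[OF assms] .
  note J = Jordan_inside_outside[OF c(1,2)]
  obtain z where z: "z \<in> D {a, b}" "z \<notin> pos ` {a, b}" using open_edge(2)[OF ab(1)] by blast
  have zH: "z \<in> - drawing H" using edge_Int_drawing[OF H ab(1,2)] z by blast
  let ?U = "connected_component_set (- drawing H) z"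
  have oU: "open ?U" and zU: "z \<in> ?U"
    using open_compl_drawing[OF H] open_connected_component zH by auto
  have meets: "?U \<inter> A \<noteq> {}" if "frontier A = path_image c" for A
  proof -
    have "z \<in> closure A" using that z c(3) by (auto simp: frontier_def)
    then show ?thesis using zU open_Int_closure_eq_empty[OF oU, of A] by blast
  qed
  obtain p q where pq: "p \<in> ?U" "p \<in> inside (path_image c)"
      "q \<in> ?U" "q \<in> outside (path_image c)"
    using meets[of "inside (path_image c)"] meets[of "outside (path_image c)"] J by blast
  have U: "?U \<in> components (- drawing H)" using zH by (rule componentsI)
  have d: "p \<in> - drawing (insert {a, b} H)" "q \<in> - drawing (insert {a, b} H)"
    using pq c(3) connected_component_subset[of "- drawing H" z]
      inside_no_overlap[of "path_image c"] outside_no_overlap[of "path_image c"]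
    unfolding drawing_insert by blast+
  let ?F = "connected_component_set (- drawing (insert {a, b} H))"
  have sub: "?F x \<subseteq> ?U" if "x \<in> ?U" "x \<in> - drawing (insert {a, b} H)" for x
  proof (rule components_maximal[OF U connected_connected_component])
    show "?F x \<subseteq> - drawing H" using connected_component_subset drawing_insert by blast
    show "?U \<inter> ?F x \<noteq> {}" using that by auto
  qed
  \<comment> \<open>A connected set with points inside and outside must meet the frontier, which is
    the Jordan curve and thus part of the drawing.\<close>
  have "?F p \<noteq> ?F q"
  proof
    assume "?F p = ?F q"
    then have "q \<in> ?F p" "p \<in> ?F p" using d by auto
    then have "?F p \<inter> inside (path_image c) \<noteq> {}" "?F p - inside (path_image c) \<noteq> {}"
      using pq inside_Int_outside[of "path_image c"] by blast+
    then have "?F p \<inter> frontier (inside (path_image c)) \<noteq> {}"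
      by (rule connected_Int_frontier[OF connected_connected_component])
    moreover have "frontier (inside (path_image c)) = path_image c" using J by simp
    ultimately show False
      using c(4) connected_component_subset[of "- drawing (insert {a, b} H)" p] by auto
  qed
  then show ?thesis
    using U sub[OF pq(1) d(1)] sub[OF pq(3) d(2)] componentsI[OF d(1)] componentsI[OF d(2)]
    by - (rule exI[of _ ?U], rule exI[of _ "?F p"], rule exI[of _ "?F q"], intro conjI)
qed

lemma connected_compl_verts: "connected (- drawing {})"
  using connected_open_delete_finite[of "UNIV :: complex set" "pos ` V"] finite_V connected_UNIV
  by (simp add: drawing_def Compl_eq_Diff_UNIV)

lemma compl_verts_nonempty: "- drawing {} \<noteq> {}"
proof
  assume "- drawing {} = {}"
  then have "pos ` V = UNIV" by (auto simp: drawing_def)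
  then have "finite (UNIV :: complex set)" using finite_V by (metis finite_imageI)
  then show False using infinite_UNIV_char_0 by blast
qed

text \<open>Induction on the edges: a bridge costs a component and no face, while an edge closing a
  cycle keeps the components and gains a face. A finite family \<open>FS\<close> is counted because
  \<open>card\<close> is 0 on infinite sets.\<close>

lemma euler_inequality:
  assumes "H \<subseteq> E"
  shows "\<exists>FS. finite FS \<and> FS \<subseteq> components (- drawing H) \<and>
    card H + num_comps V H + 1 \<le> card FS + card V"
  using finite_subset[OF assms finite_E] assms
proof (induction H rule: finite_induct)
  case empty
  have "components (- drawing {}) = {- drawing {}}"
    using connected_compl_verts compl_verts_nonempty by (simp add: components_eq_sing_iff)
  then show ?case
    by (intro exI[of _ "{- drawing {}}"]) (simp add: num_comps_empty)
next
  case (insert e H)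
  then have H: "H \<subseteq> E" and e: "e \<in> E" by auto
  obtain FS where FS: "finite FS" "FS \<subseteq> components (- drawing H)"
      "card H + num_comps V H + 1 \<le> card FS + card V"
    using insert by blast
  obtain a b where ab: "e = {a, b}" "a \<in> V" "b \<in> V" using edge[OF e] by blast
  obtain g where g: "\<And>F. F \<in> components (- drawing H) \<Longrightarrow>
      g F \<in> components (- drawing (insert e H)) \<and> g F \<subseteq> F"
    using face_below[OF H e] by metis
  \<comment> \<open>Distinct faces are disjoint, so the nonempty subfaces chosen in them
    differ.\<close>
  have inj: "inj_on g FS"
  proof (rule inj_onI)
    fix F F' assume F: "F \<in> FS" "F' \<in> FS" "g F = g F'"
    then have "g F \<subseteq> F \<inter> F'" "g F \<noteq> {}"
      using g FS(2) in_components_nonempty by blast+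
    then show "F = F'" using components_nonoverlap F FS(2) by blast
  qed
  have gFS: "g ` FS \<subseteq> components (- drawing (insert e H))" "finite (g ` FS)"
    using g FS by blast+
  show ?case
  proof (cases "(a, b) \<in> (adj H)\<^sup>*")
    case False
    have "card (insert e H) + num_comps V (insert e H) + 1 \<le> card (g ` FS) + card V"
      using num_comps_insert_bridge[OF finite_V ab(2,3) False] FS(3) insert.hyps
      unfolding card_image[OF inj] ab(1) by simp
    then show ?thesis
      using gFS by (intro exI[of _ "g ` FS"] conjI)
  next
    case True
    obtain U F1 F2 where U: "U \<in> components (- drawing H)" "F1 \<noteq> F2" "F1 \<subseteq> U" "F2 \<subseteq> U"
        "F1 \<in> components (- drawing (insert e H))" "F2 \<in> components (- drawing (insert e H))"
      using cycle_splits_face[OF H, of a b] e insert.hyps True ab by blast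
    \<comment> \<open>Of the two pieces of \<open>U\<close>, at least one is not the chosen subface
      \<open>g U\<close>; this is the gained face. \<open>U\<close> itself may lie outside
      \<open>FS\<close>.\<close>
    obtain F0 where F0: "F0 \<noteq> g U" "F0 \<subseteq> U" "F0 \<in> components (- drawing (insert e H))"
      using U by metis
    have "F0 \<notin> g ` FS"
    proof
      assume "F0 \<in> g ` FS"
      then obtain F where F: "F \<in> FS" "F0 = g F" by blast
      then have "F0 \<subseteq> F \<inter> U" "F0 \<noteq> {}" using g FS(2) F0 in_components_nonempty by blast+
      then have "F = U" using components_nonoverlap F U FS(2) by blast
      then show False using F F0 by simp
    qed
    then have "card (insert F0 (g ` FS)) = Suc (card FS)"
      using FS by (simp add: card_image[OF inj])
    moreover have "num_comps V (insert e H) = num_comps V H"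
      using num_comps_insert_cycle[OF True] ab by simp
    ultimately have "card (insert e H) + num_comps V (insert e H) + 1 \<le>
        card (insert F0 (g ` FS)) + card V"
      using FS(3) insert.hyps by simp
    moreover have "finite (insert F0 (g ` FS))" using gFS(2) by simp
    moreover have "insert F0 (g ` FS) \<subseteq> components (- drawing (insert e H))"
      using gFS(1) F0(3) by simp
    ultimately show ?thesis
      by (intro exI[of _ "insert F0 (g ` FS)"] conjI)
  qed
qed

section \<open>Forests, face boundaries and the edge bound\<close>

text \<open>Edges are added one at a time, and each joins two different components of what has been
  drawn before.\<close>

lemma forest_not_separating:
  assumes "H \<subseteq> E" "acyclic_edges H"
  shows "connected (- drawing H)"
  using finite_subset[OF assms(1) finite_E] assms
proof (induction H rule: finite_induct)
  case empty
  show ?case by (rule connected_compl_verts)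
next
  case (insert e H)
  then obtain a b where ab: "e = {a, b}" using edge[of e] by blast
  have con: "connected (- drawing H)"
    using insert acyclic_edges_subset[of "insert e H" H] by auto
  have "(a, b) \<notin> (adj H)\<^sup>*"
    using insert.prems(2) insert.hyps(2) ab by (auto simp: acyclic_edges_def)
  then show ?case
    using con bridge_not_separating[of H a b] insert.prems(1) ab
    unfolding connected_iff_connected_component by (auto simp: drawing_insert)
qed

text \<open>If the edges touching \<open>F\<close> formed a forest, the complement of their drawing
  would be connected. It meets \<open>F\<close> and misses the frontier of \<open>F\<close>, so it
  would lie within \<open>F\<close>; then no other edge is left, and \<open>E\<close> itself would
  be a forest.\<close>

lemma face_boundary_has_cycle:
  assumes "\<not> acyclic_edges E" and F: "F \<in> components (- drawing E)"
  shows "\<not> acyclic_edges {e \<in> E. touches e F}"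
proof
  define B where "B = {e \<in> E. touches e F}"
  have B: "B \<subseteq> E" by (auto simp: B_def)
  assume "acyclic_edges {e \<in> E. touches e F}"
  then have con: "connected (- drawing B)"
    using forest_not_separating[OF B] by (simp add: B_def)
  have oF: "open F" using open_components[OF open_compl_drawing[OF order_refl] F] .
  have FE: "F \<subseteq> - drawing E" "F \<noteq> {}"
    using F in_components_subset in_components_nonempty by blast+
  have "frontier F \<subseteq> drawing B"
  proof
    fix z assume "z \<in> frontier F"
    then have z: "z \<in> closure F" "z \<notin> F" using oF by (auto simp: frontier_def interior_open)
    \<comment> \<open>Otherwise \<open>insert z F\<close> would be a connected set off the drawing,
      larger than the component \<open>F\<close>.\<close>
    have "z \<in> drawing E"
    proof (rule ccontr)
      assume "z \<notin> drawing E"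
      then have "insert z F \<subseteq> - drawing E" using FE by auto
      moreover have "connected (insert z F)"
        using in_components_connected[OF F]
        by (rule connected_intermediate_closure) (use z closure_subset in auto)
      ultimately have "insert z F \<subseteq> F"
        using components_maximal[OF F] FE by blast
      then show False using z by auto
    qed
    moreover have "z \<in> drawing B" if "e \<in> E" "z \<in> D e" for e
    proof (cases "z \<in> pos ` e")
      case True
      then show ?thesis using edge_subset[OF that(1)] by (auto simp: drawing_def)
    next
      case False
      then have "e \<in> B" using that z by (auto simp: B_def touches_def)
      then show ?thesis using that by (auto simp: drawing_def)
    qed
    ultimately show "z \<in> drawing B" by (auto simp: drawing_def)
  qed
  moreover have "- drawing B \<inter> F \<noteq> {}" using FE drawing_mono[OF B] by auto
  ultimately have "- drawing B \<subseteq> F"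
    using connected_Int_frontier[OF con, of F] by blast
  then have sub: "drawing E \<subseteq> drawing B" using FE by auto
  \<comment> \<open>The drawing of \<open>B\<close> meets an edge outside \<open>B\<close> only in
    the ends of that edge, yet it would have to cover the whole edge.\<close>
  have "e \<in> B" if "e \<in> E" for e
  proof (rule ccontr)
    assume "e \<notin> B"
    then have "D e \<inter> drawing B \<subseteq> pos ` e" using edge_Int_drawing[OF B that] by simp
    moreover have "D e \<subseteq> drawing B" using sub that by (auto simp: drawing_def)
    ultimately show False using open_edge(2)[OF that] by blast
  qed
  then have "B = E" using B by auto
  then show False
    using assms(1) \<open>acyclic_edges {e \<in> E. touches e F}\<close> by (simp add: B_def)
qed

text \<open>The complement of a drawn forest is connected, so the family of faces in Euler's
  inequality has at most one member.\<close>

lemma acyclic_card_edges: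
  assumes "V \<noteq> {}" "acyclic_edges E"
  shows "card E < card V"
proof -
  obtain FS where FS: "finite FS" "FS \<subseteq> components (- drawing E)"
      "card E + num_comps V E + 1 \<le> card FS + card V"
    using euler_inequality[OF order_refl] by blast
  have con: "connected (- drawing E)" using forest_not_separating[OF order_refl assms(2)] .
  have "components (- drawing E) \<subseteq> {- drawing E}"
    using con components_eq_sing_iff[of "- drawing E"] by (cases "- drawing E = {}") auto
  then have "FS \<subseteq> {- drawing E}" using FS(2) by (rule subset_trans[rotated])
  then have "card FS \<le> card {- drawing E}" by (intro card_mono) simp
  then have "card FS \<le> 1" by simp
  then show ?thesis using FS(3) num_comps_pos[OF finite_V assms(1), of E] by linarith
qed

text \<open>Double counting of the pairs of a face and an edge touching it: at least
  \<open>k\<close> per face, at most 2 per edge. With m edges and n vertices the result is k (m - n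
  + 2) \<le> 2 m, the subtraction moved across.\<close>

theorem girth_edge_bound:
  assumes "V \<noteq> {}" "\<not> acyclic_edges E"
    and girth: "\<And>H. H \<subseteq> E \<Longrightarrow> \<not> acyclic_edges H \<Longrightarrow> k \<le> card H"
  shows "k * (card E + 2) \<le> 2 * card E + k * card V"
proof -
  obtain FS where FS: "finite FS" "FS \<subseteq> components (- drawing E)"
      "card E + num_comps V E + 1 \<le> card FS + card V"
    using euler_inequality[OF order_refl] by blast
  have "k * card FS \<le> (\<Sum>F\<in>FS. card {e \<in> E. touches e F})"
  proof -
    have "(\<Sum>F\<in>FS. k) \<le> (\<Sum>F\<in>FS. card {e \<in> E. touches e F})"
      using face_boundary_has_cycle[OF assms(2)] FS(2) by (intro sum_mono girth) auto
    then show ?thesis by (simp add: mult.commute)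
  qed
  also have "\<dots> = (\<Sum>e\<in>E. card {F \<in> FS. touches e F})"
    using FS(1) finite_E by (intro sum_multicount_gen) auto
  also have "\<dots> \<le> (\<Sum>e\<in>E. 2)"
  proof (rule sum_mono)
    fix e assume e: "e \<in> E"
    then have "{F \<in> FS. touches e F} \<subseteq> components (- drawing (insert e (E - {e})))"
      using FS(2) insert_Diff[OF e] by auto
    then show "card {F \<in> FS. touches e F} \<le> 2"
      using e by (intro edge_two_faces[of "E - {e}" e]) simp_all
  qed
  finally have "k * card FS \<le> 2 * card E" by simp
  moreover have "k * (card E + 2) \<le> k * (card FS + card V)"
    using FS(3) num_comps_pos[OF finite_V assms(1), of E] by (intro mult_le_mono2) linarith
  ultimately show ?thesis by (simp add: algebra_simps)
qed

end

section \<open>Simple planar graphs\<close>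

definition uedges :: "'a pair_pre_digraph \<Rightarrow> 'a set set" where
  "uedges G = (\<lambda>(u, v). {u, v}) ` parcs G"

lemma (in pair_graph) arc_sym: "(u, v) \<in> parcs G \<Longrightarrow> (v, u) \<in> parcs G"
  using pair_sym_arcs by (auto simp: symmetric_def dest: symD)

lemma (in pair_graph) in_uedges_iff: "{u, v} \<in> uedges G \<longleftrightarrow> (u, v) \<in> parcs G"
  by (auto simp: uedges_def doubleton_eq_iff dest: arc_sym)

text \<open>The union runs over the two orientations of \<open>e\<close>. Their curves are reverses
  of each other and have the same image, so the union is that image and no orientation has to be
  chosen.\<close>

lemma (in pair_graph) plane_drawing_drawn_graph:
  assumes "plane_drawing G pos crv"
  shows "drawn_graph (pverts G) (uedges G) pos
    (\<lambda>e. \<Union>{path_image (crv (u, v)) | u v. (u, v) \<in> parcs G \<and> {u, v} = e})"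
proof -
  let ?D = "\<lambda>e. \<Union>{path_image (crv (u, v)) | u v. (u, v) \<in> parcs G \<and> {u, v} = e}"
  note d = assms[unfolded plane_drawing_def]
  note pd = conjunct1[OF d] conjunct1[OF conjunct2[OF d], rule_format]
    conjunct2[OF conjunct2[OF d], rule_format]
  have D: "?D {u, v} = path_image (crv (u, v))" if uv: "(u, v) \<in> parcs G" for u v
  proof -
    have "path_image (crv (x, y)) = path_image (crv (u, v))" if "{x, y} = {u, v}" for x y
    proof -
      have "path_image (crv (v, u)) = path_image (crv (u, v))"
        using pd(2)[OF uv] path_image_reversepath by metis
      moreover have "(x = u \<and> y = v) \<or> (x = v \<and> y = u)"
        using that by (simp add: doubleton_eq_iff)
      ultimately show ?thesis by fast
    qed
    then have "{path_image (crv (x, y)) | x y. (x, y) \<in> parcs G \<and> {x, y} = {u, v}} =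
        {path_image (crv (u, v))}"
      using uv by blast
    then show ?thesis by simp
  qed
  have E: "\<exists>u v. e = {u, v} \<and> (u, v) \<in> parcs G" if "e \<in> uedges G" for e
    using that by (auto simp: uedges_def)
  show ?thesis
  proof
    show "finite (pverts G)" "finite (uedges G)"
      using pair_finite_verts pair_finite_arcs by (auto simp: uedges_def)
    show "inj_on pos (pverts G)" by (rule pd(1))
  next
    fix e assume "e \<in> uedges G"
    then obtain u v where uv: "e = {u, v}" "(u, v) \<in> parcs G" using E by blast
    have "u \<noteq> v" "u \<in> pverts G" "v \<in> pverts G"
      using uv(2) pair_no_loops[OF uv(2)] in_arcsD1 in_arcsD2 by simp_all
    then show "\<exists>u v g. e = {u, v} \<and> u \<noteq> v \<and> u \<in> pverts G \<and> v \<in> pverts G \<and> Path_Connected.arc g \<and>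
        path_image g = ?D e \<and> pathstart g = pos u \<and> pathfinish g = pos v"
      using pd(2)[OF uv(2)] uv(1) unfolding uv(1) D[OF uv(2)] by blast
    show "?D e \<inter> pos ` pverts G \<subseteq> pos ` e"
      using pd(2)[OF uv(2)] unfolding uv(1) D[OF uv(2)] by simp
  next
    fix e e' assume "e \<in> uedges G" "e' \<in> uedges G" and ne: "e \<noteq> e'"
    then obtain u v x y where uv: "e = {u, v}" "(u, v) \<in> parcs G" "e' = {x, y}" "(x, y) \<in> parcs G"
      using E by meson
    show "?D e \<inter> ?D e' \<subseteq> pos ` (e \<inter> e')"
      using pd(3)[OF uv(2,4)] ne unfolding uv(1,3) D[OF uv(2)] D[OF uv(4)] by blast
  qed
qed

section \<open>Cycles and the girth\<close>

lemma (in pair_graph) path_edges_awalk: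
  assumes "xs \<noteq> []" "path_edges xs \<subseteq> uedges G"
  shows "pcas (hd xs) (zip xs (tl xs)) (last xs)" "pawalk_verts (hd xs) (zip xs (tl xs)) = xs"
    "set (zip xs (tl xs)) \<subseteq> parcs G"
  using assms by (induction xs rule: path_edges.induct) (auto simp: in_uedges_iff)

lemma (in pair_graph) cycle_of_path:
  assumes xs: "xs \<noteq> []" "distinct xs" "path_edges xs \<subseteq> uedges G"
    and closing: "{hd xs, last xs} \<in> uedges G"
  shows "\<exists>p. cycle p \<and> length p = length xs"
proof -
  \<comment> \<open>The closed walk starts at \<open>last xs\<close>, so the tail of its vertex list
    is exactly \<open>xs\<close>, whose distinctness makes the walk a \<open>cycle\<close>.\<close>
  let ?p = "(last xs, hd xs) # zip xs (tl xs)"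
  have arc: "(last xs, hd xs) \<in> parcs G"
    using closing in_uedges_iff arc_sym by blast
  then have "awalk (last xs) ?p (last xs)"
    using path_edges_awalk[OF xs(1,3)] in_arcsD1 by (auto simp: awalk_def)
  then have "cycle ?p"
    using path_edges_awalk(2)[OF xs(1,3)] xs(2) by (auto simp: cycle_def intro!: exI[of _ "last xs"])
  moreover have "length ?p = length xs"
    using xs(1) by (cases xs) auto
  ultimately show ?thesis by blast
qed

text \<open>An edge of \<open>H\<close> that is no bridge closes a simple path in the rest of
  \<open>H\<close> into a cycle with all its edges in \<open>H\<close>.\<close>

lemma (in pair_graph) girth_le_card_cyclic:
  assumes "girth G \<ge> enat k" and H: "H \<subseteq> uedges G" "\<not> acyclic_edges H"
  shows "k \<le> card H"
proof -
  obtain a b where ab: "{a, b} \<in> H" "(a, b) \<in> (adj (H - {{a, b}}))\<^sup>*"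
    using H(2) by (auto simp: acyclic_edges_def)
  obtain xs where xs: "xs \<noteq> []" "hd xs = a" "last xs = b" "distinct xs"
      "path_edges xs \<subseteq> H - {{a, b}}"
    using rtrancl_adj_simple_path[OF ab(2)] by blast
  have "(a, b) \<in> parcs G" using ab(1) H(1) in_uedges_iff by blast
  then have "a \<noteq> b" using pair_no_loops[of "(a, b)"] by simp
  \<comment> \<open>Only lengths from 3 on count for \<open>girth\<close>. The path is not a single
    vertex because \<open>a\<close> and \<open>b\<close> differ, and not the edge itself because
    that was removed.\<close>
  have len: "3 \<le> length xs"
  proof (rule ccontr)
    assume "\<not> 3 \<le> length xs"
    then consider x where "xs = [x]" | x y where "xs = [x, y]"
      using xs(1) by (cases xs rule: path_edges.cases) (auto simp: not_le less_Suc_eq_le)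
    then show False
    proof cases
      case 1
      then show False using xs(2,3) \<open>a \<noteq> b\<close> by simp
    next
      case 2
      then show False using xs(2,3,5) by simp
    qed
  qed
  have "path_edges xs \<subseteq> uedges G" using xs(5) H(1) by blast
  then obtain p where p: "cycle p" "length p = length xs"
    using cycle_of_path[OF xs(1,4)] xs(2,3) ab(1) H(1) by blast
  then have "girth G \<le> enat (length p)"
    unfolding girth_def using len by (intro INF_lower) auto
  then have "k \<le> length xs"
    using assms(1) p(2) by (metis enat_ord_simps(1) order_trans)
  moreover have fin: "finite H"
    using finite_subset[OF H(1)] pair_finite_arcs by (auto simp: uedges_def)
  have "card (insert {a, b} (path_edges xs)) \<le> card H"
    using xs(5) ab(1) by (intro card_mono fin) auto
  moreover have "{a, b} \<notin> path_edges xs" using xs(5) by blast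
  \<comment> \<open>The path has one edge fewer than vertices, and the closing edge makes up the
    difference.\<close>
  ultimately show ?thesis
    using card_path_edges[OF xs(4)] xs(1) by (cases xs) auto
qed

text \<open>The face count works only if there is a cycle; a forest has fewer edges than vertices,
  which implies the claim directly.\<close>

lemma (in pair_graph) planar_girth_edge_bound:
  assumes "planar G" "pverts G \<noteq> {}" "girth G \<ge> enat k" "3 \<le> k"
  shows "(k - 2) * card (uedges G) < k * card (pverts G)"
proof -
  obtain pos crv where "plane_drawing G pos crv" using assms(1) by (auto simp: planar_def)
  then interpret drawn_graph "pverts G" "uedges G" pos
    "\<lambda>e. \<Union>{path_image (crv (u, v)) | u v. (u, v) \<in> parcs G \<and> {u, v} = e}"
    by (rule plane_drawing_drawn_graph)
  show ?thesis
  proof (cases "acyclic_edges (uedges G)")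
    case True
    then have "card (uedges G) < card (pverts G)"
      using acyclic_card_edges assms(2) by blast
    then have "(k - 2) * card (uedges G) \<le> k * card (uedges G)"
      and "k * card (uedges G) < k * card (pverts G)"
      using assms(4) by auto
    then show ?thesis by (rule le_less_trans)
  next
    case False
    have "k * (card (uedges G) + 2) \<le> 2 * card (uedges G) + k * card (pverts G)"
      using assms(2) False girth_le_card_cyclic[OF assms(3)] by (rule girth_edge_bound)
    moreover have "k * card (uedges G) = (k - 2) * card (uedges G) + 2 * card (uedges G)"
    proof -
      have "k = (k - 2) + 2" using assms(4) by simp
      then show ?thesis by (metis add_mult_distrib)
    qed
    \<comment> \<open>The positive surplus \<open>2 * k\<close> makes the final inequality
      strict.\<close>
    ultimately have "(k - 2) * card (uedges G) + 2 * k \<le> k * card (pverts G)"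
      by (simp add: add_mult_distrib2)
    then show ?thesis using assms(4) by linarith
  qed
qed

section \<open>Degree sums and discharging\<close>

lemma (in pair_graph) vdegree_eq_card: "vdegree G v = card {w. (v, w) \<in> parcs G}"
proof -
  have "out_arcs G v = Pair v ` {w. (v, w) \<in> parcs G}"
    by (auto simp: out_arcs_def)
  then show ?thesis
    by (simp add: vdegree_def out_degree_def card_image inj_on_def)
qed

lemma (in pair_graph) finite_neighbours: "finite {w. (v, w) \<in> parcs G}"
  by (rule finite_subset[OF _ pair_finite_verts]) (auto dest: in_arcsD2)

lemma (in pair_graph) sum_vdegree: "(\<Sum>v\<in>pverts G. vdegree G v) = card (parcs G)"
proof -
  have "parcs G = Sigma (pverts G) (\<lambda>v. {w. (v, w) \<in> parcs G})"
    by (auto dest: in_arcsD1)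
  then have "card (parcs G) = card (Sigma (pverts G) (\<lambda>v. {w. (v, w) \<in> parcs G}))"
    by simp
  also have "\<dots> = (\<Sum>v\<in>pverts G. vdegree G v)"
    using pair_finite_verts finite_neighbours by (simp add: card_SigmaI vdegree_eq_card)
  finally show ?thesis by simp
qed

text \<open>The arcs are counted along the fibres of the map that forgets the orientation; each
  fibre has at most two elements.\<close>

lemma (in pair_graph) card_arcs_le: "card (parcs G) \<le> 2 * card (uedges G)"
proof -
  have "card (parcs G) = (\<Sum>e\<in>uedges G. card {a \<in> parcs G. (\<lambda>(u, v). {u, v}) a = e})"
    using sum.image_gen[OF pair_finite_arcs, of "\<lambda>_. 1 :: nat" "\<lambda>(u, v). {u, v}"]
    by (simp add: uedges_def)
  also have "\<dots> \<le> (\<Sum>e\<in>uedges G. 2)"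
  proof (rule sum_mono)
    fix e assume "e \<in> uedges G"
    then obtain u v where "e = {u, v}" by (auto simp: uedges_def)
    then have "{a \<in> parcs G. (\<lambda>(u, v). {u, v}) a = e} \<subseteq> {(u, v), (v, u)}"
      by (auto simp: doubleton_eq_iff split: prod.splits)
    then have "card {a \<in> parcs G. (\<lambda>(u, v). {u, v}) a = e} \<le> card {(u, v), (v, u)}"
      by (intro card_mono) auto
    also have "\<dots> \<le> 2" by (cases "u = v") simp_all
    finally show "card {a \<in> parcs G. (\<lambda>(u, v). {u, v}) a = e} \<le> 2" .
  qed
  finally show ?thesis by simp
qed

text \<open>
  Discharging: every vertex of degree at least 3 sends charge 1/4 to each of its neighbours of
  degree 2; afterwards every vertex has charge at least 5/2. All charges are multiplied by 4.
\<close>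

lemma (in pair_graph) discharging:
  assumes min2: "\<And>v. v \<in> pverts G \<Longrightarrow> vdegree G v \<ge> 2"
    and no_a: "\<And>u v. (u, v) \<in> parcs G \<Longrightarrow> vdegree G u = 2 \<Longrightarrow> vdegree G v \<noteq> 2"
    and no_b: "\<And>v. v \<in> pverts G \<Longrightarrow> vdegree G v \<ge> 3 \<Longrightarrow> \<exists>w. (v, w) \<in> parcs G \<and> vdegree G w \<noteq> 2"
  shows "10 * card (pverts G) \<le> 4 * card (parcs G)"
proof -
  define V2 where "V2 = {v \<in> pverts G. vdegree G v = 2}"
  define V3 where "V3 = {v \<in> pverts G. vdegree G v \<ge> 3}"
  have V: "pverts G = V2 \<union> V3" "V2 \<inter> V3 = {}" "finite V2" "finite V3"
    using min2 pair_finite_verts by (force simp: V2_def V3_def)+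
  have split: "(\<Sum>v\<in>pverts G. f v) = (\<Sum>v\<in>V2. f v) + (\<Sum>v\<in>V3. f v)" for f :: "'a \<Rightarrow> nat"
    unfolding V(1) using V(2-4) by (simp add: sum.union_disjoint)
  \<comment> \<open>Both neighbours of a vertex of degree 2 have degree at least 3, so its final
    charge is 4 * 2 + 2 = 10.\<close>
  have received: "card {u \<in> V3. (u, w) \<in> parcs G} = 2" if "w \<in> V2" for w
  proof -
    have "{u \<in> V3. (u, w) \<in> parcs G} = {u. (w, u) \<in> parcs G}"
    proof (intro equalityI subsetI)
      fix u assume "u \<in> {u. (w, u) \<in> parcs G}"
      then have wu: "(w, u) \<in> parcs G" by simp
      then have "u \<in> pverts G" "vdegree G u \<noteq> 2"
        using no_a[OF wu] that in_arcsD2 by (auto simp: V2_def)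
      then show "u \<in> {u \<in> V3. (u, w) \<in> parcs G}"
        using min2[of u] arc_sym[OF wu] by (simp add: V3_def)
    qed (auto intro: arc_sym)
    then show ?thesis using that by (simp add: V2_def vdegree_eq_card)
  qed
  \<comment> \<open>The neighbour supplied by \<open>no_b\<close> receives nothing, so
    \<open>u\<close> sends at most \<open>vdegree G u - 1\<close> units.\<close>
  have sent: "card {w \<in> V2. (u, w) \<in> parcs G} + 1 \<le> vdegree G u" if u: "u \<in> V3" for u
  proof -
    obtain w where "(u, w) \<in> parcs G" "vdegree G w \<noteq> 2" using no_b[of u] u by (auto simp: V3_def)
    then have "{w \<in> V2. (u, w) \<in> parcs G} \<subset> {w. (u, w) \<in> parcs G}" by (auto simp: V2_def)
    from psubset_card_mono[OF finite_neighbours this] show ?thesis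
      by (simp add: vdegree_eq_card[of u])
  qed
  \<comment> \<open>Exchanging the order of summation equates the charge sent with the charge
    received.\<close>
  have "(\<Sum>u\<in>V3. card {w \<in> V2. (u, w) \<in> parcs G}) = (\<Sum>w\<in>V2. 2)"
    using V(3,4) received by (intro sum_multicount_gen) auto
  then have total: "(\<Sum>u\<in>V3. card {w \<in> V2. (u, w) \<in> parcs G}) = 2 * card V2" by simp
  have "(\<Sum>u\<in>V3. 10 + card {w \<in> V2. (u, w) \<in> parcs G}) \<le> (\<Sum>u\<in>V3. 4 * vdegree G u)"
  proof (rule sum_mono)
    fix u assume u: "u \<in> V3"
    then have "3 \<le> vdegree G u" by (simp add: V3_def)
    \<comment> \<open>For degree d the charge kept is at least 4 d - (d - 1) = 3 d + 1, and this is
      at least 10 from d = 3 on.\<close>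
    with sent[OF u] show "10 + card {w \<in> V2. (u, w) \<in> parcs G} \<le> 4 * vdegree G u" by linarith
  qed
  then have "10 * card V3 + 2 * card V2 \<le> 4 * (\<Sum>u\<in>V3. vdegree G u)"
    by (simp add: sum.distrib total flip: sum_distrib_left)
  moreover have "(\<Sum>u\<in>V2. vdegree G u) = 2 * card V2"
    by (simp add: V2_def)
  moreover have "card (pverts G) = card V2 + card V3"
    using split[of "\<lambda>_. 1"] by simp
  ultimately show ?thesis
    using split[of "vdegree G"] sum_vdegree by linarith
qed

theorem theorem12:
  fixes G :: "'a pair_pre_digraph"
  assumes "pair_graph G"
    and "pverts G \<noteq> {}"
    and "planar G"
    and "min_degree G \<ge> 2"
    and "girth G \<ge> 10"
  shows "(\<exists>u v. (u, v) \<in> parcs G \<and> vdegree G u = 2 \<and> vdegree G v = 2) \<or>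
    (\<exists>v \<in> pverts G. vdegree G v \<ge> 3 \<and> (\<forall>w. (v, w) \<in> parcs G \<longrightarrow> vdegree G w = 2))"
proof (rule ccontr)
  assume neg: "\<not> ?thesis"
  interpret pair_graph G by (rule assms(1))
  have "vdegree G v \<ge> 2" if "v \<in> pverts G" for v
  proof -
    have "min_degree G \<le> vdegree G v"
      unfolding min_degree_def using that pair_finite_verts by (intro Min_le) auto
    then show ?thesis using assms(4) by linarith
  qed
  then have "10 * card (pverts G) \<le> 4 * card (parcs G)"
    using neg by (intro discharging) blast+
  moreover have "girth G \<ge> enat 10"
    using assms(5) by (simp add: numeral_eq_enat)
  from planar_girth_edge_bound[OF assms(3,2) this]
  have "8 * card (uedges G) < 10 * card (pverts G)" by simp
  \<comment> \<open>With n vertices and m edges: 10 n \<le> 4 * \<open>card (parcs G)\<close> \<le>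
    8 m < 10 n.\<close>
  ultimately show False using card_arcs_le by linarith
qed

end
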